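(* Let $K,L$ be non-negative integers and let $\alpha_1,\ldots,\alpha_L>0$. Let $k$ be a non-negative integer satisfying $2K-L\le 2k\le 2K$. Let $\gamma$ be a closed contour in the complex plane going around $0$ once in the positive direction, and let $$W(z)=\frac{W_{\alpha_1}(z)W_{\alpha_2}(z)\cdots W_{\alpha_L}(z)}{z^{K}},\qquad W_{\alpha}(z)=\begin{pmatrix}\alpha&1\\ z&1\end{pmatrix}.$$ Then there exists a unique monic $2\times 2$ matrix-valued polynomial $P_k(z)=z^kI_2+\cdots$ of degree $k$ such that $$\frac{1}{2\pi i}\oint_\gamma P_k(z)W(z)z^j\,dz=0_2,\qquad j=0,1,\ldots,k-1.$$
   Context: A monic matrix-valued polynomial of degree $k$ and size $2\times2$ is $P_k(z)=z^kI_2+\sum_{i=0}^{k-1}C_iz^i$ with $C_i\in\mathbb{C}^{2\times2}$. Integrals of matrix-valued functions are taken entrywise; $0_2$ and $I_2$ are the $2\times2$ zero and identity matrices. An empty product of matrices is $I_2$. *)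

theory Defs
  imports "HOL-Complex_Analysis.Complex_Analysis"
begin

type_synonym cmat2 = "complex ^ 2 ^ 2"

text \<open>Entrywise scaling: on nested vectors neither \<open>*\<^sub>R\<close> (real scalars) nor \<open>*s\<close> (scalars from
  the row type) multiplies a complex matrix by a complex scalar.\<close>
definition cscale :: "complex \<Rightarrow> cmat2 \<Rightarrow> cmat2" (infixr "*\<^sub>c" 75) where
  "c *\<^sub>c A = (\<chi> i j. c * A $ i $ j)"

text \<open>The ordered product \<open>F 1 ** F 2 ** \<dots> ** F n\<close>; the factors are indexed from 1.\<close>
primrec matprod :: "(nat \<Rightarrow> cmat2) \<Rightarrow> nat \<Rightarrow> cmat2" where
  "matprod F 0 = mat 1"
| "matprod F (Suc n) = matprod F n ** F (Suc n)"

definition W_factor :: "real \<Rightarrow> complex \<Rightarrow> cmat2" where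
  "W_factor a z = vector [vector [complex_of_real a, 1], vector [z, 1]]"

definition weight :: "nat \<Rightarrow> nat \<Rightarrow> (nat \<Rightarrow> real) \<Rightarrow> complex \<Rightarrow> cmat2" where
  "weight K L \<alpha> z = (1 / z ^ K) *\<^sub>c matprod (\<lambda>i. W_factor (\<alpha> i) z) L"

text \<open>Polynomials are identified with polynomial functions on the complex plane, which determine
  their coefficients. (The type \<open>cmat2 poly\<close> is unsuitable, as the multiplication of the vector
  type is entrywise.)\<close>
definition monic_mat_poly :: "nat \<Rightarrow> (complex \<Rightarrow> cmat2) \<Rightarrow> bool" where
  "monic_mat_poly k P \<longleftrightarrow>
     (\<exists>C :: nat \<Rightarrow> cmat2. \<forall>z. P z = z ^ k *\<^sub>c mat 1 + (\<Sum>i<k. z ^ i *\<^sub>c C i))"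

definition mat_contour_integral :: "(real \<Rightarrow> complex) \<Rightarrow> (complex \<Rightarrow> cmat2) \<Rightarrow> cmat2" where
  "mat_contour_integral \<gamma> F = (\<chi> i j. contour_integral \<gamma> (\<lambda>z. F z $ i $ j))"

end

theory Submission imports Defs
begin

text \<open>
  The rows of \<open>P\<close> can be treated separately. Interlace the coefficients of a row \<open>(p, q)\<close> into a
  single sequence \<open>x\<close> with \<open>x (2n)\<close> the coefficient of \<open>z\<^sup>n\<close> in \<open>p\<close> and \<open>x (2n+1)\<close> that in \<open>q\<close>. Then
  right multiplication by \<open>W_factor \<alpha> z\<close>, which sends \<open>(p, q)\<close> to \<open>(\<alpha> p + z q, p + q)\<close>, becomes the
  scalar bidiagonal map \<open>y m = a m * x m + x (m - 1)\<close> with \<open>a m > 0\<close>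
  (\<open>interlace_row_times\<close>). Since a contour integral around the origin reads off a coefficient,
  orthogonality says that after \<open>L\<close> bidiagonal steps the sequence vanishes on the window
  \<open>{2(K-k)..<2K}\<close> of length \<open>2k\<close> (\<open>orthogonality_iff\<close>). The unknowns are the \<open>2k\<close> entries of the
  initial sequence below position \<open>2k\<close>; the remaining ones are fixed by monicity. So this is a square
  linear system, and existence and uniqueness both follow once the homogeneous system has only the
  zero solution.

  That is where positivity enters. A positive bidiagonal map cannot create sign changes
  (\<open>alternates_bidiagonal\<close>), and a real sequence supported on \<open>N\<close> points has fewer than \<open>N\<close> of them. But
  if the image of \<open>x\<close> vanishes on \<open>N\<close> consecutive points, then \<open>a m * x m = - x (m - 1)\<close> there, so on
  the \<open>N + 1\<close> points involved \<open>x\<close> is either zero throughout or changes sign \<open>N\<close> times. The second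
  case is excluded, so going back one step makes the zero window grow by one point on the left
  (\<open>zero_window_backwards\<close>). After \<open>L\<close> steps back, the window \<open>{d..<d+N}\<close> has become \<open>{d-L..<d+N}\<close>,
  which contains the whole support \<open>{0..<N}\<close> because \<open>0 \<le> d \<le> L\<close>. With \<open>d = 2(K-k)\<close>, that is
  the hypothesis on \<open>k\<close>.
\<close>

section \<open>Linear systems\<close>

text \<open>Gaussian elimination, one equation at a time: a pivot solves the last equation for one
  unknown, and substituting it leaves one equation and one unknown fewer. The size of the system is
  a variable, which is why it is indexed by sets rather than by finite types.\<close>
lemma nontrivial_kernel:
  fixes M :: "nat \<Rightarrow> 'b \<Rightarrow> 'a::field"
  assumes "finite J" and "m < card J"
  shows "\<exists>x. (\<exists>j\<in>J. x j \<noteq> 0) \<and> (\<forall>i<m. (\<Sum>j\<in>J. M i j * x j) = 0)"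
  using assms
proof (induction m arbitrary: J M)
  case 0
  then obtain j where "j \<in> J" by (metis card.empty ex_in_conv less_irrefl)
  then show ?case by (intro exI[of _ "\<lambda>_. 1"]) auto
next
  case (Suc m)
  show ?case
  proof (cases "\<forall>j\<in>J. M m j = 0")
    case True
    from Suc.IH[of J M] Suc.prems obtain x where
      x: "\<exists>j\<in>J. x j \<noteq> 0" "\<forall>i<m. (\<Sum>j\<in>J. M i j * x j) = 0" by auto
    then show ?thesis using True by (auto simp: less_Suc_eq intro!: exI[of _ x])
  next
    case False
    then obtain p where p: "p \<in> J" "M m p \<noteq> 0" by blast
    define J' where "J' = J - {p}"
    have J': "finite J'" "p \<notin> J'" "J = insert p J'" using Suc.prems p by (auto simp: J'_def)
    have "m < card J'" using Suc.prems J' by simp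
    from Suc.IH[OF J'(1) this, of "\<lambda>i j. M i j - M i p * M m j / M m p"]
    obtain x where x: "\<exists>j\<in>J'. x j \<noteq> 0"
      "\<And>i. i < m \<Longrightarrow> (\<Sum>j\<in>J'. (M i j - M i p * M m j / M m p) * x j) = 0" by auto
    define s where "s = (\<Sum>j\<in>J'. M m j * x j)"
    define y where "y = x(p := - s / M m p)"
    have y_sum: "(\<Sum>j\<in>J. M i j * y j) = (\<Sum>j\<in>J'. M i j * x j) - M i p / M m p * s" for i
    proof -
      have "(\<Sum>j\<in>J'. M i j * y j) = (\<Sum>j\<in>J'. M i j * x j)"
        using J'(2) by (intro sum.cong) (auto simp: y_def)
      then show ?thesis using J' by (simp add: y_def)
    qed
    have "(\<Sum>j\<in>J. M i j * y j) = 0" if "i < Suc m" for i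
    proof (cases "i = m")
      case True
      then show ?thesis using p by (simp add: y_sum s_def)
    next
      case False
      then have "(\<Sum>j\<in>J'. (M i j - M i p * M m j / M m p) * x j) = 0" using x that by simp
      moreover have "(\<Sum>j\<in>J'. (M i j - M i p * M m j / M m p) * x j)
        = (\<Sum>j\<in>J'. M i j * x j) - M i p / M m p * s"
        by (simp add: s_def left_diff_distrib right_diff_distrib sum_subtractf sum_distrib_left mult_ac)
      ultimately show ?thesis by (simp add: y_sum)
    qed
    moreover have "\<exists>j\<in>J. y j \<noteq> 0" using x(1) J' by (auto simp: y_def)
    ultimately show ?thesis by blast
  qed
qed

text \<open>Appending \<open>- b\<close> as a further column gives more unknowns than equations. In a nontrivial solution
  of that system the new unknown cannot vanish, by injectivity, so it can be scaled to one.\<close>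
lemma square_system_solvable:
  fixes M :: "nat \<Rightarrow> nat \<Rightarrow> 'a::field"
  assumes inj: "\<And>x. (\<forall>i<n. (\<Sum>j<n. M i j * x j) = 0) \<Longrightarrow> \<forall>j<n. x j = 0"
  shows "\<exists>x. \<forall>i<n. (\<Sum>j<n. M i j * x j) = b i"
proof -
  define M' where "M' = (\<lambda>i j. if j = n then - b i else M i j)"
  have "n < card {..n}" by simp
  from nontrivial_kernel[OF _ this, of M'] obtain x where
    nz: "\<exists>j\<le>n. x j \<noteq> 0" and ker: "\<forall>i<n. (\<Sum>j\<le>n. M' i j * x j) = 0" by auto
  have sum': "(\<Sum>j\<le>n. M' i j * x j) = (\<Sum>j<n. M i j * x j) - b i * x n" for i
    by (simp add: lessThan_Suc_atMost[symmetric] M'_def)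
  have "x n \<noteq> 0"
  proof
    assume "x n = 0"
    with ker sum' inj[of x] have "\<forall>j<n. x j = 0" by simp
    with nz \<open>x n = 0\<close> show False by (auto simp: le_less)
  qed
  moreover have "(\<Sum>j<n. M i j * x j) = b i * x n" if "i < n" for i
    using ker sum'[of i] that by simp
  ultimately have "\<forall>i<n. (\<Sum>j<n. M i j * (x j / x n)) = b i"
    by (simp flip: sum_divide_distrib)
  then show ?thesis by (intro exI[of _ "\<lambda>j. x j / x n"])
qed

section \<open>Sign changes under positive bidiagonal matrices\<close>

text \<open>The sequence has at least \<open>r\<close> sign changes. The witnesses are listed in decreasing order, the
  direction in which a zero window of the image propagates; \<open>s\<close> only carries the initial sign.\<close>
definition alternates :: "nat \<Rightarrow> (int \<Rightarrow> real) \<Rightarrow> bool" where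
  "alternates r x \<longleftrightarrow> (\<exists>f :: nat \<Rightarrow> int. \<exists>s.
     (\<forall>i\<le>r. s * (-1) ^ i * x (f i) > 0) \<and> (\<forall>i<r. f (Suc i) < f i))"

text \<open>The sign of \<open>y m\<close> must occur in \<open>x m\<close> or in \<open>x (m - 1)\<close>. Choosing such a position for each witness
  keeps the positions in weak order, and two consecutive ones cannot coincide because their signs
  differ.\<close>
lemma alternates_bidiagonal:
  assumes a: "\<And>m. a m > 0" and y: "\<And>m. y m = a m * x m + x (m - 1)"
    and alt: "alternates r y"
  shows "alternates r x"
proof -
  obtain f s where f: "\<And>i. i \<le> r \<Longrightarrow> s * (-1) ^ i * y (f i) > 0"
    "\<And>i. i < r \<Longrightarrow> f (Suc i) < f i"
    using alt unfolding alternates_def by blast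
  have "\<exists>n\<in>{f i - 1, f i}. s * (-1) ^ i * x n > 0" if "i \<le> r" for i
  proof (rule ccontr)
    assume neg: "\<not> ?thesis"
    define t where "t = s * (-1) ^ i"
    have "t * x (f i) \<le> 0" "t * x (f i - 1) \<le> 0" using neg by (auto simp: t_def not_less)
    then have "a (f i) * (t * x (f i)) + t * x (f i - 1) \<le> 0"
      using a[of "f i"] by (meson add_nonpos_nonpos less_imp_le mult_nonneg_nonpos)
    then have "t * y (f i) \<le> 0" unfolding y by (simp add: algebra_simps)
    with f(1)[OF that] show False by (simp add: t_def)
  qed
  then obtain g where g: "\<And>i. i \<le> r \<Longrightarrow> g i \<in> {f i - 1, f i} \<and> s * (-1) ^ i * x (g i) > 0"
    by metis
  have "g (Suc i) < g i" if "i < r" for i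
  proof -
    have "g (Suc i) \<le> f (Suc i)" "f (Suc i) \<le> f i - 1" "f i - 1 \<le> g i"
      using g[of i] g[of "Suc i"] f(2)[OF that] that by auto
    then have "g (Suc i) \<le> g i" by linarith
    moreover have "g (Suc i) \<noteq> g i"
    proof
      assume "g (Suc i) = g i"
      then have "s * (-1) ^ i * x (g i) < 0" using g[of "Suc i"] that by simp
      then show False using g[of i] that by simp
    qed
    ultimately show ?thesis by simp
  qed
  with g show ?thesis unfolding alternates_def by blast
qed

lemma not_alternates_finite_support:
  assumes supp: "\<And>m. x m \<noteq> 0 \<Longrightarrow> 0 \<le> m \<and> m < int N"
  shows "\<not> alternates N x"
proof
  assume "alternates N x"
  then obtain f s where f: "\<And>i. i \<le> N \<Longrightarrow> s * (-1) ^ i * x (f i) > 0"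
    "\<And>i. i < N \<Longrightarrow> f (Suc i) < f i"
    unfolding alternates_def by blast
  have "f i \<le> f 0 - int i" if "i \<le> N" for i
    using that
  proof (induction i)
    case (Suc i)
    then show ?case using f(2)[of i] by simp
  qed simp
  from this[of N] have "f N \<le> f 0 - int N" by simp
  moreover have "x (f 0) \<noteq> 0" "x (f N) \<noteq> 0" using f(1)[of 0] f(1)[of N] by auto
  ultimately show False using supp[of "f 0"] supp[of "f N"] by linarith
qed

text \<open>On the window, \<open>x (m - 1)\<close> is a negative multiple of \<open>x m\<close>. So a zero at the upper end would
  spread to the whole range, and otherwise the signs alternate all the way down from \<open>e - 1\<close>.\<close>
lemma alternates_before_zero_window:
  assumes a: "\<And>m. a m > 0" and y: "\<And>m. y m = a m * x m + x (m - 1)"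
    and window: "\<And>m. d \<le> m \<Longrightarrow> m < e \<Longrightarrow> y m = 0"
    and long: "d + int N \<le> e" and nz: "d - 1 \<le> m0" "m0 < e" "x m0 \<noteq> 0"
  shows "alternates N x"
proof -
  have rec: "x (m - 1) = - a m * x m" if "d \<le> m" "m < e" for m
    using window[OF that] y[of m] by (simp add: add_eq_0_iff)
  have top: "x (e - 1) \<noteq> 0"
  proof
    assume "x (e - 1) = 0"
    have "x m = 0" if "m \<le> e - 1" "d - 1 \<le> m" for m
      using that
    proof (induction m rule: int_le_induct)
      case base then show ?case using \<open>x (e - 1) = 0\<close> by simp
    next
      case (step i)
      then show ?case using rec[of i] by simp
    qed
    then show False using nz by simp
  qed
  have "x (e - 1) * (-1) ^ i * x (e - 1 - int i) > 0" if "i \<le> N" for i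
    using that
  proof (induction i)
    case 0
    then show ?case using top by (auto simp: zero_less_mult_iff)
  next
    case (Suc i)
    define m where "m = e - 1 - int i"
    have m: "e - 1 - int (Suc i) = m - 1" "d \<le> m" "m < e" using Suc.prems long by (auto simp: m_def)
    have "x (e - 1) * (-1) ^ i * x m * a m > 0" using Suc a[of m] by (simp add: m_def)
    then show ?case unfolding m(1) rec[OF m(2,3)] by (simp add: mult_ac)
  qed
  then show ?thesis unfolding alternates_def
    by (intro exI[of _ "\<lambda>i. e - 1 - int i"] exI[of _ "x (e - 1)"]) auto
qed

text \<open>The upper end \<open>e\<close> stays fixed while the lower end moves left by one with each step undone. No
  intermediate sequence can alternate \<open>N\<close> times, because the initial one does not.\<close>
lemma zero_window_backwards:
  fixes y :: "nat \<Rightarrow> int \<Rightarrow> real"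
  assumes "\<And>l m. l < n \<Longrightarrow> a l m > 0"
    and "\<And>l m. l < n \<Longrightarrow> y (Suc l) m = a l m * y l m + y l (m - 1)"
    and supp: "\<And>m. y 0 m \<noteq> 0 \<Longrightarrow> 0 \<le> m \<and> m < int N"
    and "\<And>m. d \<le> m \<Longrightarrow> m < e \<Longrightarrow> y n m = 0"
    and "d + int N \<le> e"
    and "d - int n \<le> m" "m < e"
  shows "y 0 m = 0"
  using assms(1,2,4-)
proof (induction n arbitrary: d)
  case 0
  then show ?case by simp
next
  case (Suc n)
  note pos = Suc.prems(1) and rec = Suc.prems(2)
  have "\<not> alternates N (y l)" if "l \<le> n" for l
    using that
  proof (induction l)
    case 0
    then show ?case using not_alternates_finite_support[OF supp] by simp
  next
    case (Suc l)
    then have "l < Suc n" "\<not> alternates N (y l)" by simp_all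
    with alternates_bidiagonal[of "a l" "y (Suc l)" "y l" N] pos rec show ?case by blast
  qed
  then have "y n m = 0" if "d - 1 \<le> m" "m < e" for m
    using alternates_before_zero_window[of "a n" "y (Suc n)" "y n" d e N m] Suc.prems that by auto
  from Suc.IH[OF _ _ this, of "d - 1"] show ?case using Suc.prems by auto
qed

section \<open>The weight acting on interlaced coefficient sequences\<close>

text \<open>The sequences are indexed by the integers, so that the shift needs no boundary case at
  position zero.\<close>
primrec bidiag_iter :: "(nat \<Rightarrow> real) \<Rightarrow> nat \<Rightarrow> (int \<Rightarrow> complex) \<Rightarrow> int \<Rightarrow> complex" where
  "bidiag_iter \<alpha> 0 x = x"
| "bidiag_iter \<alpha> (Suc l) x = (\<lambda>m. of_real (if even m then \<alpha> (Suc l) else 1) * bidiag_iter \<alpha> l x m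
     + bidiag_iter \<alpha> l x (m - 1))"

lemma bidiag_iter_add:
  "bidiag_iter \<alpha> l (\<lambda>m. x m + y m) = (\<lambda>m. bidiag_iter \<alpha> l x m + bidiag_iter \<alpha> l y m)"
  by (induction l) (auto simp: algebra_simps)

lemma bidiag_iter_diff:
  "bidiag_iter \<alpha> l (\<lambda>m. x m - y m) = (\<lambda>m. bidiag_iter \<alpha> l x m - bidiag_iter \<alpha> l y m)"
  by (induction l) (auto simp: algebra_simps)

lemma bidiag_iter_sum:
  "bidiag_iter \<alpha> l (\<lambda>m. \<Sum>j\<in>J. c j * x j m) = (\<lambda>m. \<Sum>j\<in>J. c j * bidiag_iter \<alpha> l (x j) m)"
  by (induction l) (auto simp: sum_distrib_left sum.distrib algebra_simps)

text \<open>The bidiagonal maps are real, so the sign argument applies to real and imaginary parts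
  separately.\<close>
lemma bidiag_iter_window_injective:
  assumes \<alpha>: "\<And>i. 1 \<le> i \<Longrightarrow> i \<le> L \<Longrightarrow> \<alpha> i > 0" and d: "0 \<le> d" "d \<le> int L"
    and supp: "\<And>m. m \<notin> {0..<int N} \<Longrightarrow> x m = 0"
    and window: "\<And>m. m \<in> {d..<d + int N} \<Longrightarrow> bidiag_iter \<alpha> L x m = 0"
  shows "x m = 0"
proof (cases "m \<in> {0..<int N}")
  case True
  define a where "a = (\<lambda>l (m::int). if even m then \<alpha> (Suc l) else 1)"
  have a: "a l m > 0" if "l < L" for l m using \<alpha> that by (auto simp: a_def)
  have supp': "0 \<le> m \<and> m < int N" if "Re (x m) \<noteq> 0 \<or> Im (x m) \<noteq> 0" for m
    using supp[of m] that by fastforce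
  have "Re (bidiag_iter \<alpha> 0 x m) = 0"
    by (rule zero_window_backwards[where n = L and a = a and N = N and d = d and e = "d + int N"
          and y = "\<lambda>l m. Re (bidiag_iter \<alpha> l x m)"])
       (use a d window supp' True in \<open>auto simp: a_def\<close>)
  moreover have "Im (bidiag_iter \<alpha> 0 x m) = 0"
    by (rule zero_window_backwards[where n = L and a = a and N = N and d = d and e = "d + int N"
          and y = "\<lambda>l m. Im (bidiag_iter \<alpha> l x m)"])
       (use a d window supp' True in \<open>auto simp: a_def\<close>)
  ultimately show ?thesis by (simp add: complex_eq_iff)
qed (rule supp)

text \<open>The affine form of the square system: \<open>u\<close> prescribes the entries outside \<open>{0..<N}\<close>, and the \<open>N\<close>
  free ones are determined by the window. For a monic polynomial \<open>u\<close> carries the leading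
  coefficient.\<close>
lemma bidiag_iter_window_unique_solution:
  assumes \<alpha>: "\<And>i. 1 \<le> i \<Longrightarrow> i \<le> L \<Longrightarrow> \<alpha> i > 0" and d: "0 \<le> d" "d \<le> int L"
  shows "\<exists>!x. (\<forall>m. m \<notin> {0..<int N} \<longrightarrow> x m = u m) \<and>
    (\<forall>m\<in>{d..<d + int N}. bidiag_iter \<alpha> L x m = 0)"
proof (rule ex_ex1I)
  \<comment> \<open>Unit sequences and their combinations identify the sequences supported on \<open>{0..<N}\<close> with vectors
    of length \<open>N\<close>; \<open>M\<close> is the matrix of the iterated map restricted to the window.\<close>
  define E where "E = (\<lambda>(j::nat) (m::int). if m = int j then 1 else 0 :: complex)"
  define comb where "comb = (\<lambda>x (m::int). \<Sum>j<N. x j * E j m)"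
  have comb_in: "comb x (int j) = x j" if "j < N" for x j
    using that by (simp add: comb_def E_def if_distrib[of "(*) _"] cong: if_cong)
  have comb_out: "comb x m = 0" if "m \<notin> {0..<int N}" for x m
    using that by (auto simp: comb_def E_def intro!: sum.neutral)
  define M where "M = (\<lambda>i j. bidiag_iter \<alpha> L (E j) (d + int i))"
  have image: "bidiag_iter \<alpha> L (comb x) (d + int i) = (\<Sum>j<N. M i j * x j)" for x i
    unfolding comb_def bidiag_iter_sum M_def by (simp add: mult.commute)
  have window_nat: "(\<forall>m\<in>{d..<d + int N}. P m) \<longleftrightarrow> (\<forall>i<N. P (d + int i))" for P
  proof
    assume P: "\<forall>i<N. P (d + int i)"
    show "\<forall>m\<in>{d..<d + int N}. P m"
    proof
      fix m assume "m \<in> {d..<d + int N}"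
      then have "nat (m - d) < N" "d + int (nat (m - d)) = m" by auto
      with P show "P m" by metis
    qed
  qed simp
  have "\<forall>j<N. x j = 0" if "\<forall>i<N. (\<Sum>j<N. M i j * x j) = 0" for x
  proof -
    have window: "\<forall>m\<in>{d..<d + int N}. bidiag_iter \<alpha> L (comb x) m = 0"
      unfolding window_nat image using that .
    have "comb x m = 0" for m
      by (rule bidiag_iter_window_injective[where L = L and \<alpha> = \<alpha> and d = d and N = N and x = "comb x"])
         (use \<alpha> d comb_out window in \<open>simp_all only:\<close>)
    then show ?thesis using comb_in[of _ x] by simp
  qed
  from square_system_solvable[OF this,
      where b = "\<lambda>i. - bidiag_iter \<alpha> L (\<lambda>m. if m \<in> {0..<int N} then 0 else u m) (d + int i)"]
  obtain x where x: "\<forall>i<N. (\<Sum>j<N. M i j * x j)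
    = - bidiag_iter \<alpha> L (\<lambda>m. if m \<in> {0..<int N} then 0 else u m) (d + int i)" by blast
  define w where "w = (\<lambda>m. comb x m + (if m \<in> {0..<int N} then 0 else u m))"
  have "bidiag_iter \<alpha> L w (d + int i) = 0" if "i < N" for i
    unfolding w_def bidiag_iter_add image using x[rule_format, OF that] by (simp only: add.left_inverse)
  then have "\<forall>m\<in>{d..<d + int N}. bidiag_iter \<alpha> L w m = 0"
    unfolding window_nat by blast
  moreover have "\<forall>m. m \<notin> {0..<int N} \<longrightarrow> w m = u m" using comb_out by (simp add: w_def)
  ultimately show "\<exists>x. (\<forall>m. m \<notin> {0..<int N} \<longrightarrow> x m = u m) \<and>
    (\<forall>m\<in>{d..<d + int N}. bidiag_iter \<alpha> L x m = 0)" by (intro exI[of _ w] conjI)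
next
  fix x y
  assume x: "(\<forall>m. m \<notin> {0..<int N} \<longrightarrow> x m = u m) \<and>
      (\<forall>m\<in>{d..<d + int N}. bidiag_iter \<alpha> L x m = 0)"
    and y: "(\<forall>m. m \<notin> {0..<int N} \<longrightarrow> y m = u m) \<and>
      (\<forall>m\<in>{d..<d + int N}. bidiag_iter \<alpha> L y m = 0)"
  have "x m - y m = 0" for m
    by (rule bidiag_iter_window_injective[where L = L and \<alpha> = \<alpha> and d = d and N = N
          and x = "\<lambda>m. x m - y m"])
       (use \<alpha> d x y in \<open>auto simp: bidiag_iter_diff\<close>)
  then show "x = y" by auto
qed

definition interlace :: "complex poly \<times> complex poly \<Rightarrow> int \<Rightarrow> complex" where
  "interlace pq m = (if m < 0 then 0
     else Polynomial.coeff (if even m then fst pq else snd pq) (nat (m div 2)))"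

lemma interlace_even: "interlace pq (2 * int n) = Polynomial.coeff (fst pq) n"
  and interlace_odd: "interlace pq (2 * int n + 1) = Polynomial.coeff (snd pq) n"
  by (auto simp: interlace_def)

lemma interlace_inject:
  assumes "interlace pq = interlace pq'"
  shows "pq = pq'"
proof (rule prod_eqI; rule poly_eqI)
  fix n
  show "Polynomial.coeff (fst pq) n = Polynomial.coeff (fst pq') n"
    using interlace_even[of pq n] interlace_even[of pq' n] assms by simp
  show "Polynomial.coeff (snd pq) n = Polynomial.coeff (snd pq') n"
    using interlace_odd[of pq n] interlace_odd[of pq' n] assms by simp
qed

lemma int_parity_cases:
  fixes m :: int
  obtains "m < 0" | n where "m = 2 * int n" | n where "m = 2 * int n + 1"
proof (cases "m < 0")
  case False
  then have "m = 2 * int (nat (m div 2)) \<or> m = 2 * int (nat (m div 2)) + 1" by auto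
  then show ?thesis using that by blast
qed (use that in blast)

primrec row_times :: "(nat \<Rightarrow> real) \<Rightarrow> nat \<Rightarrow> complex poly \<times> complex poly
    \<Rightarrow> complex poly \<times> complex poly" where
  "row_times \<alpha> 0 pq = pq"
| "row_times \<alpha> (Suc l) pq =
     (smult (of_real (\<alpha> (Suc l))) (fst (row_times \<alpha> l pq)) + pCons 0 (snd (row_times \<alpha> l pq)),
      fst (row_times \<alpha> l pq) + snd (row_times \<alpha> l pq))"

text \<open>The factor \<open>z\<close> in the lower left entry of \<open>W_factor\<close> moves the odd entries of the second
  polynomial up to the next even position, and the ones in the right column add each even entry to
  the odd one that follows. Both are the same shift by one.\<close>
lemma interlace_row_times: "interlace (row_times \<alpha> l pq) = bidiag_iter \<alpha> l (interlace pq)"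
proof (induction l)
  case (Suc l)
  define x where "x = row_times \<alpha> l pq"
  have "interlace (row_times \<alpha> (Suc l) pq) m =
    of_real (if even m then \<alpha> (Suc l) else 1) * interlace x m + interlace x (m - 1)" for m
  proof (cases m rule: int_parity_cases)
    case 1
    then show ?thesis by (simp add: interlace_def)
  next
    case (2 n)
    show ?thesis
    proof (cases n)
      case 0
      with 2 show ?thesis by (simp add: interlace_def x_def)
    next
      case (Suc n')
      then have "m - 1 = 2 * int n' + 1" using 2 by simp
      then show ?thesis using 2 Suc
        by (simp only: interlace_even interlace_odd) (simp add: x_def)
    qed
  next
    case (3 n)
    then have "m - 1 = 2 * int n" by simp
    then show ?thesis using 3
      by (simp only: interlace_even interlace_odd) (simp add: x_def)
  qed
  then show ?case unfolding bidiag_iter.simps Suc.IH[symmetric] x_def by auto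
qed simp

definition pair_nth :: "'a \<times> 'a \<Rightarrow> 2 \<Rightarrow> 'a" where
  "pair_nth pq e = (if e = 1 then fst pq else snd pq)"

lemma matprod_row:
  fixes A :: cmat2
  assumes "\<And>e. A $ r $ e = poly (pair_nth pq e) z"
  shows "(A ** matprod (\<lambda>i. W_factor (\<alpha> i) z) l) $ r $ e = poly (pair_nth (row_times \<alpha> l pq) e) z"
proof (induction l arbitrary: e)
  case 0
  then show ?case using assms by simp
next
  case (Suc l)
  define B where "B = A ** matprod (\<lambda>i. W_factor (\<alpha> i) z) l"
  have "A ** matprod (\<lambda>i. W_factor (\<alpha> i) z) (Suc l) = B ** W_factor (\<alpha> (Suc l)) z"
    by (simp add: B_def matrix_mul_assoc)
  moreover have "B $ r $ e = poly (pair_nth (row_times \<alpha> l pq) e) z" for e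
    using Suc by (simp add: B_def)
  ultimately show ?case using exhaust_2[of e]
    by (auto simp: matrix_matrix_mult_def sum_2 W_factor_def pair_nth_def mult_ac)
qed

section \<open>Contour integrals as coefficients\<close>

text \<open>The residue theorem on the whole plane; the only pole is the origin, and the residue of
  \<open>q(z) / z\<^sup>n\<^sup>+\<^sup>1\<close> is a Taylor coefficient of \<open>q\<close>.\<close>
lemma contour_integral_poly_over_power:
  fixes q :: "complex poly"
  assumes \<gamma>: "valid_path \<gamma>" "pathfinish \<gamma> = pathstart \<gamma>" "0 \<notin> path_image \<gamma>" "winding_number \<gamma> 0 = 1"
  shows "contour_integral \<gamma> (\<lambda>z. poly q z / z ^ Suc n) = 2 * pi * \<i> * Polynomial.coeff q n"
proof -
  have "contour_integral \<gamma> (\<lambda>z. poly q z / z ^ Suc n)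
    = 2 * pi * \<i> * (\<Sum>p\<in>{0}. winding_number \<gamma> p * residue (\<lambda>z. poly q z / z ^ Suc n) p)"
    by (rule Residue_theorem[of UNIV]) (use \<gamma> in \<open>auto intro!: holomorphic_intros\<close>)
  moreover have "poly q has_fps_expansion fps_of_poly q"
    by (simp add: has_fps_expansion_def)
  from residue_fps_expansion_over_power_at_0[OF this]
  have "residue (\<lambda>z. poly q z / z ^ Suc n) 0 = Polynomial.coeff q n" by simp
  ultimately show ?thesis using \<gamma> by simp
qed

section \<open>Existence and uniqueness\<close>

definition monic_row :: "nat \<Rightarrow> (nat \<Rightarrow> cmat2) \<Rightarrow> 2 \<Rightarrow> complex poly \<times> complex poly" where
  "monic_row k C r =
    (monom (if r = 1 then 1 else 0) k + (\<Sum>i<k. monom (C i $ r $ 1) i),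
     monom (if r = 2 then 1 else 0) k + (\<Sum>i<k. monom (C i $ r $ 2) i))"

definition monic_eval :: "nat \<Rightarrow> (nat \<Rightarrow> cmat2) \<Rightarrow> complex \<Rightarrow> cmat2" where
  "monic_eval k C z = z ^ k *\<^sub>c mat 1 + (\<Sum>i<k. z ^ i *\<^sub>c C i)"

lemma monic_eval_nth: "monic_eval k C z $ r $ e = poly (pair_nth (monic_row k C r) e) z"
  using exhaust_2[of r] exhaust_2[of e]
  by (auto simp: monic_eval_def monic_row_def pair_nth_def cscale_def mat_def poly_monom poly_sum
      mult.commute)

lemma coeff_monic_row:
  "Polynomial.coeff (pair_nth (monic_row k C r) e) n =
    (if n < k then C n $ r $ e else if n = k \<and> r = e then 1 else 0)"
  using exhaust_2[of r] exhaust_2[of e]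
  by (auto simp: monic_row_def pair_nth_def coeff_sum)

lemma cscale_eq_0_iff:
  assumes "c \<noteq> 0"
  shows "c *\<^sub>c A = 0 \<longleftrightarrow> (\<forall>r e. A $ r $ e = 0)"
  using assms by (simp add: cscale_def vec_eq_iff)

text \<open>The integral against \<open>z\<^sup>j / z\<^sup>K\<close> picks out the coefficient of \<open>z\<^sup>K\<^sup>-\<^sup>1\<^sup>-\<^sup>j\<close>, so \<open>j < k\<close> covers the
  degrees from \<open>K - k\<close> to \<open>K - 1\<close> in both columns. Interlaced, these fill a window of \<open>2k\<close>
  consecutive positions.\<close>
lemma orthogonality_iff:
  fixes C :: "nat \<Rightarrow> cmat2"
  assumes \<gamma>: "valid_path \<gamma>" "pathfinish \<gamma> = pathstart \<gamma>" "0 \<notin> path_image \<gamma>" "winding_number \<gamma> 0 = 1"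
    and "k \<le> K"
  shows "(\<forall>j<k. (1 / (2 * of_real pi * \<i>)) *\<^sub>c
        mat_contour_integral \<gamma> (\<lambda>z. z ^ j *\<^sub>c (monic_eval k C z ** weight K L \<alpha> z)) = 0)
    \<longleftrightarrow> (\<forall>r. \<forall>m\<in>{2 * (int K - int k)..<2 * (int K - int k) + int (2 * k)}.
          bidiag_iter \<alpha> L (interlace (monic_row k C r)) m = 0)"
proof -
  define q where "q = (\<lambda>r. row_times \<alpha> L (monic_row k C r))"
  have entry: "mat_contour_integral \<gamma> (\<lambda>z. z ^ j *\<^sub>c (monic_eval k C z ** weight K L \<alpha> z)) $ r $ e
    = 2 * pi * \<i> * Polynomial.coeff (pair_nth (q r) e) (K - 1 - j)" if "j < k" for j r e
  proof -
    have "(z ^ j *\<^sub>c (monic_eval k C z ** weight K L \<alpha> z)) $ r $ e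
      = poly (pair_nth (q r) e) z / z ^ Suc (K - 1 - j)" if "z \<in> path_image \<gamma>" for z
    proof -
      have "z \<noteq> 0" using that \<gamma> by auto
      have "(monic_eval k C z ** weight K L \<alpha> z) $ r $ e =
        (1 / z ^ K) * (monic_eval k C z ** matprod (\<lambda>i. W_factor (\<alpha> i) z) L) $ r $ e"
        by (simp add: weight_def cscale_def matrix_matrix_mult_def sum_distrib_left mult_ac)
      also have "\<dots> = poly (pair_nth (q r) e) z / z ^ K"
        using matprod_row[OF monic_eval_nth] by (simp add: q_def)
      also have "z ^ K = z ^ j * z ^ Suc (K - 1 - j)"
        unfolding power_add[symmetric] using \<open>j < k\<close> \<open>k \<le> K\<close> by simp
      finally have "z ^ j * (monic_eval k C z ** weight K L \<alpha> z) $ r $ e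
        = poly (pair_nth (q r) e) z / z ^ Suc (K - 1 - j)"
        using \<open>z \<noteq> 0\<close> by (simp del: power_Suc)
      then show ?thesis by (simp only: cscale_def vec_lambda_beta)
    qed
    then have "mat_contour_integral \<gamma> (\<lambda>z. z ^ j *\<^sub>c (monic_eval k C z ** weight K L \<alpha> z)) $ r $ e
      = contour_integral \<gamma> (\<lambda>z. poly (pair_nth (q r) e) z / z ^ Suc (K - 1 - j))"
      unfolding mat_contour_integral_def by (simp only: vec_lambda_beta) (rule contour_integral_eq)
    then show ?thesis using contour_integral_poly_over_power[OF \<gamma>] by simp
  qed
  have "(\<forall>j<k. (1 / (2 * of_real pi * \<i>)) *\<^sub>c
        mat_contour_integral \<gamma> (\<lambda>z. z ^ j *\<^sub>c (monic_eval k C z ** weight K L \<alpha> z)) = 0)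
    \<longleftrightarrow> (\<forall>r e. \<forall>j<k. Polynomial.coeff (pair_nth (q r) e) (K - 1 - j) = 0)"
    by (auto simp: cscale_eq_0_iff entry)
  also have "\<dots> \<longleftrightarrow> (\<forall>r. \<forall>m\<in>{2 * (int K - int k)..<2 * (int K - int k) + int (2 * k)}.
      interlace (q r) m = 0)"
  proof (intro iffI allI ballI impI)
    fix r m
    assume c: "\<forall>r e. \<forall>j<k. Polynomial.coeff (pair_nth (q r) e) (K - 1 - j) = 0"
      and m: "m \<in> {2 * (int K - int k)..<2 * (int K - int k) + int (2 * k)}"
    have c': "Polynomial.coeff (pair_nth (q r) e) n = 0" if "K - k \<le> n" "n < K" for e n
      using c[rule_format, of "K - 1 - n" r e] that \<open>k \<le> K\<close> by simp
    show "interlace (q r) m = 0"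
    proof (cases m rule: int_parity_cases)
      case 1
      then show ?thesis by (simp add: interlace_def)
    next
      case (2 n)
      then have "K - k \<le> n" "n < K" using m by auto
      then show ?thesis using c'[of n 1] 2 by (simp add: interlace_even pair_nth_def)
    next
      case (3 n)
      then have "K - k \<le> n" "n < K" using m by auto
      then show ?thesis using c'[of n 2] 3 by (simp add: interlace_odd pair_nth_def)
    qed
  next
    fix r e j
    assume w: "\<forall>r. \<forall>m\<in>{2 * (int K - int k)..<2 * (int K - int k) + int (2 * k)}.
      interlace (q r) m = 0" and j: "j < k"
    define n where "n = K - 1 - j"
    have n: "K - k \<le> n" "n < K" using j \<open>k \<le> K\<close> by (auto simp: n_def)
    have "interlace (q r) (2 * int n) = 0" "interlace (q r) (2 * int n + 1) = 0"
      using w n \<open>k \<le> K\<close> by auto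
    then show "Polynomial.coeff (pair_nth (q r) e) (K - 1 - j) = 0"
      by (simp add: interlace_even interlace_odd pair_nth_def n_def)
  qed
  finally show ?thesis by (simp add: q_def interlace_row_times)
qed

theorem proposition1p1:
  fixes K L k :: nat and \<alpha> :: "nat \<Rightarrow> real" and \<gamma> :: "real \<Rightarrow> complex"
  assumes \<alpha>_pos: "\<And>i. 1 \<le> i \<Longrightarrow> i \<le> L \<Longrightarrow> \<alpha> i > 0"
    and k_lower: "2 * int K - int L \<le> 2 * int k"
    and k_upper: "2 * int k \<le> 2 * int K"
    and \<gamma>_contour: "valid_path \<gamma>" "pathfinish \<gamma> = pathstart \<gamma>"
    and \<gamma>_around_0: "0 \<notin> path_image \<gamma>" "winding_number \<gamma> 0 = 1"
  shows "\<exists>!P. monic_mat_poly k P \<and>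
    (\<forall>j<k. (1 / (2 * of_real pi * \<i>)) *\<^sub>c
        mat_contour_integral \<gamma> (\<lambda>z. z ^ j *\<^sub>c (P z ** weight K L \<alpha> z)) = 0)"
proof -
  define d where "d = 2 * (int K - int k)"
  \<comment> \<open>The leading coefficient \<open>I\<^sub>2\<close> puts a one at degree \<open>k\<close> into column \<open>r\<close> of row \<open>r\<close>, that is, at
    position \<open>2k\<close> or \<open>2k + 1\<close> of the interlaced row.\<close>
  define lead where "lead = (\<lambda>(r::2) m. if m = 2 * int k + (if r = 1 then 0 else 1) then 1 else 0 :: complex)"
  define sol where "sol = (\<lambda>r x. (\<forall>m. m \<notin> {0..<int (2 * k)} \<longrightarrow> x m = lead r m) \<and>
      (\<forall>m\<in>{d..<d + int (2 * k)}. bidiag_iter \<alpha> L x m = 0))"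
  have d: "0 \<le> d" "d \<le> int L" using k_lower k_upper by (auto simp: d_def)
  have sol_ex1: "\<exists>!x. sol r x" for r
    unfolding sol_def by (rule bidiag_iter_window_unique_solution) (use \<alpha>_pos d in auto)
  have parity: "2 * int n \<noteq> 2 * int k + 1" "2 * int n + 1 \<noteq> 2 * int k" for n
    by presburger+
  have row_lead: "interlace (monic_row k C r) m = lead r m" if "m \<notin> {0..<int (2 * k)}" for C r m
    using that exhaust_2[of r] coeff_monic_row[of k C r 1] coeff_monic_row[of k C r 2]
    by (cases m rule: int_parity_cases)
       (auto simp: interlace_even interlace_odd pair_nth_def lead_def interlace_def parity)
  have orth: "(\<forall>j<k. (1 / (2 * of_real pi * \<i>)) *\<^sub>c
        mat_contour_integral \<gamma> (\<lambda>z. z ^ j *\<^sub>c (monic_eval k C z ** weight K L \<alpha> z)) = 0)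
    \<longleftrightarrow> (\<forall>r. sol r (interlace (monic_row k C r)))" for C
    using orthogonality_iff[OF \<gamma>_contour \<gamma>_around_0, of k K C L \<alpha>] k_upper row_lead
    by (simp add: sol_def d_def)
  have monic: "monic_mat_poly k P \<longleftrightarrow> (\<exists>C. P = monic_eval k C)" for P
    by (auto simp: monic_mat_poly_def monic_eval_def fun_eq_iff)
  show ?thesis
  proof (rule ex_ex1I)
    obtain x where x: "\<And>r. sol r (x r)" using sol_ex1 by metis
    define C :: "nat \<Rightarrow> cmat2"
      where "C = (\<lambda>i. \<chi> r e. x r (2 * int i + (if e = 1 then 0 else 1)))"
    have "interlace (monic_row k C r) m = x r m" for r m
    proof (cases "m \<in> {0..<int (2 * k)}")
      case True
      then show ?thesis using coeff_monic_row[of k C r 1] coeff_monic_row[of k C r 2]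
        by (cases m rule: int_parity_cases)
           (auto simp: interlace_even interlace_odd pair_nth_def C_def)
    next
      case False
      then show ?thesis using row_lead[OF False] x[of r] by (simp add: sol_def)
    qed
    then have "interlace (monic_row k C r) = x r" for r by auto
    then have "\<forall>r. sol r (interlace (monic_row k C r))" using x by simp
    moreover have "monic_mat_poly k (monic_eval k C)" unfolding monic by blast
    ultimately show "\<exists>P. monic_mat_poly k P \<and>
      (\<forall>j<k. (1 / (2 * of_real pi * \<i>)) *\<^sub>c
        mat_contour_integral \<gamma> (\<lambda>z. z ^ j *\<^sub>c (P z ** weight K L \<alpha> z)) = 0)"
      using orth[of C] by (intro exI[of _ "monic_eval k C"] conjI) simp_all
  next
    fix P Q
    assume P: "monic_mat_poly k P \<and> (\<forall>j<k. (1 / (2 * of_real pi * \<i>)) *\<^sub>c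
        mat_contour_integral \<gamma> (\<lambda>z. z ^ j *\<^sub>c (P z ** weight K L \<alpha> z)) = 0)"
      and Q: "monic_mat_poly k Q \<and> (\<forall>j<k. (1 / (2 * of_real pi * \<i>)) *\<^sub>c
        mat_contour_integral \<gamma> (\<lambda>z. z ^ j *\<^sub>c (Q z ** weight K L \<alpha> z)) = 0)"
    obtain C D where CD: "P = monic_eval k C" "Q = monic_eval k D" using P Q monic by blast
    have "sol r (interlace (monic_row k C r))" "sol r (interlace (monic_row k D r))" for r
      using P Q orth[of C] orth[of D] unfolding CD by simp_all
    then have "interlace (monic_row k C r) = interlace (monic_row k D r)" for r
      using sol_ex1[of r] by blast
    then have "monic_row k C r = monic_row k D r" for r
      by (rule interlace_inject)
    then show "P = Q" unfolding CD by (auto simp: vec_eq_iff monic_eval_nth)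
  qed
qed

end
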